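(* Let $\lambda\in\overline{\mathbb Q}\cap\mathbb R$ with $\lambda>1$. There are continuum many (that is, $2^{\aleph_0}$ distinct) functions $$f(z)=\sum_{k\geq 0}a_kz^k\in\overline{\mathbb Q}[[z]],$$ analytic in $B(0,1)$ and having radius of convergence exactly $1$, whose coefficients satisfy $a_k\in\mathcal D_\lambda$ for every $k\geq 0$, and such that, for every integer $s\geq 0$, $$f^{(s)}\bigl(\overline{\mathbb Q}\cap B(0,1)\bigr)\subseteq\overline{\mathbb Q}.$$ Moreover, every derivative $f^{(s)}$ ($s\geq 0$) is transcendental over $\mathbb C(z)$.
   Context: $\overline{\mathbb Q}\subset\mathbb C$ is the field of algebraic numbers and $B(0,1)$ is the open unit disk in $\mathbb C$. For a real algebraic number $\lambda>1$, $$\mathcal D_\lambda:=\{0\}\cup\{\gamma\in\overline{\mathbb Q}:|\gamma|=\lambda^m\text{ for some }m\in\mathbb Z_{\geq 0}\}.$$ Here $f^{(s)}$ is the $s$-th derivative, with $f^{(0)}=f$. An analytic function $g$ is transcendental over $\mathbb C(z)$ if it satisfies no identity $P(z,g(z))=0$ with $0\neq P\in\mathbb C(z)[Y]$. *)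

theory Defs
  imports
    "HOL-Complex_Analysis.Complex_Analysis"
    "HOL-Computational_Algebra.Computational_Algebra"
    "HOL-Computational_Algebra.Field_as_Ring"
    "HOL-Library.Equipollence"
begin

definition D_lambda :: "real \<Rightarrow> complex set" where
  "D_lambda l = {0} \<union> {\<gamma>. algebraic \<gamma> \<and> (\<exists>m::nat. norm \<gamma> = l ^ m)}"

text \<open>
  The field of rational functions is the fraction field of the ring of complex polynomials. The
  library function \<open>quot_of_fract\<close> returns the representation of a fraction in lowest terms, so the
  poles of a rational function are exactly the zeros of the second component.
\<close>

definition ratfun_pole :: "complex poly fract \<Rightarrow> complex \<Rightarrow> bool" where
  "ratfun_pole r z \<longleftrightarrow> poly (snd (quot_of_fract r)) z = 0"

definition ratfun_eval :: "complex poly fract \<Rightarrow> complex \<Rightarrow> complex" where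
  "ratfun_eval r z = poly (fst (quot_of_fract r)) z / poly (snd (quot_of_fract r)) z"

text \<open>
  The identity \<open>P(z, g(z)) = 0\<close> on \<open>U\<close> is an identity of meromorphic functions. It is therefore
  required exactly at the points of \<open>U\<close> that are not among the finitely many poles of the
  coefficients of \<open>P\<close>. The notion is meant for \<open>g\<close> analytic on a nonempty connected open set \<open>U\<close>.
\<close>

definition transcendental_over_ratfuns_on :: "complex set \<Rightarrow> (complex \<Rightarrow> complex) \<Rightarrow> bool" where
  "transcendental_over_ratfuns_on U g \<longleftrightarrow>
     \<not> (\<exists>P :: complex poly fract poly. P \<noteq> 0 \<and>
          (\<forall>z\<in>U. (\<forall>i. \<not> ratfun_pole (coeff P i) z) \<longrightarrow>
             (\<Sum>i\<le>degree P. ratfun_eval (coeff P i) z * g z ^ i) = 0))"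

end

theory Submission
  imports Defs
begin

text \<open>
  For a single algebraic \<open>b\<close> with \<open>\<bar>b\<bar> < 1\<close>, a relation \<open>l ^ p = l ^ q u b ^ i + l ^ r v b ^ j\<close> with
  algebraic \<open>u\<close>, \<open>v\<close> of modulus 1 exists as soon as the three lengths involved form a triangle, so
  \<open>b\<close> is a zero of a polynomial with coefficients in \<open>D_lambda l\<close>. Since \<open>D_lambda l\<close> is closed under
  multiplication, replacing \<open>P(z)\<close> by \<open>P(z) A(z ^ N)\<close> with \<open>N > deg P\<close> and \<open>A(b ^ N) = 0\<close> adds one
  more zero, so zeros and their multiplicities can be prescribed one after the other.

  Enumerate the algebraic numbers of the unit disk as \<open>a\<^sub>0, a\<^sub>1, \<dots>\<close> and take \<open>f = \<Sum>\<^sub>n \<plusminus> B\<^sub>n\<close>, where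
  \<open>B\<^sub>n\<close> has coefficients in \<open>D_lambda l\<close>, vanishes at \<open>a\<^sub>0, \<dots>, a\<^sub>n\<close> to order \<open>n + 1\<close>, and is multiplied
  by such a high power of \<open>z\<close> that its coefficients are bounded by their index and that it is
  separated from \<open>B\<^sub>n\<^sub>-\<^sub>1\<close> by a long gap. Then \<open>f\<^sup>(\<^sup>s\<^sup>)(a\<^sub>j)\<close> is a finite sum of algebraic numbers, the gaps
  force transcendence, and the signs give continuum many functions.
\<close>

section \<open>The field of algebraic numbers\<close>

text \<open>Rational linear algebra serves a criterion: an element is algebraic iff all its powers
  lie in the span of one finite set. This passes to sums and products.\<close>

interpretation rat_span: vector_space "\<lambda>(q::rat) (x::'a::field_char_0). of_rat q * x"
  by unfold_locales (auto simp: of_rat_add of_rat_mult algebra_simps)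

lemma rat_span_mult:
  assumes "x \<in> rat_span.span A" "y \<in> rat_span.span B"
  shows "x * y \<in> rat_span.span {a * b |a b. a \<in> A \<and> b \<in> B}" (is "_ \<in> ?S")
proof -
  have left: "a * y \<in> ?S" if "a \<in> A" for a
    using assms(2)
  proof (induction rule: rat_span.span_induct_alt)
    case base
    then show ?case by (simp add: rat_span.span_zero)
  next
    case (step c b z)
    have "a * b \<in> ?S" using step that by (intro rat_span.span_base) auto
    then have "of_rat c * (a * b) + a * z \<in> ?S"
      using step by (intro rat_span.span_add rat_span.span_scale)
    then show ?case by (simp add: algebra_simps)
  qed
  show ?thesis using assms(1)
  proof (induction rule: rat_span.span_induct_alt)
    case base
    then show ?case by (simp add: rat_span.span_zero)
  next
    case (step c a z)
    then have "of_rat c * (a * y) + z * y \<in> ?S"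
      by (intro rat_span.span_add rat_span.span_scale[OF left])
    then show ?case by (simp add: algebra_simps)
  qed
qed

text \<open>For a root \<open>x\<close> of a polynomial of degree \<open>N\<close>, the powers below
  \<open>N\<close> suffice: the equation multiplied by \<open>x ^ (n - N)\<close> expresses
  \<open>x ^ n\<close> by lower powers.\<close>

lemma algebraic_imp_powers_in_finite_span:
  fixes x :: "'a::field_char_0"
  assumes "algebraic x"
  obtains T where "finite T" "\<And>n. x ^ n \<in> rat_span.span T"
proof -
  from assms obtain p where p: "\<And>i. coeff p i \<in> \<rat>" "p \<noteq> 0" "poly p x = 0"
    unfolding algebraic_altdef by blast
  define N where "N = degree p"
  define T where "T = (\<lambda>i. x ^ i) ` {..<N}"
  have "x ^ n \<in> rat_span.span T" for n
  proof (induction n rule: less_induct)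
    case (less n)
    show ?case
    proof (cases "n < N")
      case True
      then show ?thesis by (auto simp: T_def intro: rat_span.span_base)
    next
      case False
      have "x ^ n = (\<Sum>i<N. (- (coeff p i / coeff p N)) * x ^ (i + (n - N)))"
      proof -
        have "0 = x ^ (n - N) * (\<Sum>i\<le>N. coeff p i * x ^ i)"
          using p(3) by (simp add: poly_altdef N_def)
        also have "{..N} = insert N {..<N}" by auto
        also have "x ^ (n - N) * (\<Sum>i\<in>\<dots>. coeff p i * x ^ i) =
            coeff p N * x ^ n + (\<Sum>i<N. coeff p i * x ^ (i + (n - N)))"
          using False by (simp add: algebra_simps sum_distrib_left power_add flip: power_add)
        finally have "coeff p N * x ^ n = - (\<Sum>i<N. coeff p i * x ^ (i + (n - N)))"
          by (simp add: eq_neg_iff_add_eq_0)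
        then have "x ^ n = - (\<Sum>i<N. coeff p i * x ^ (i + (n - N))) / coeff p N"
          using p(2) by (simp add: N_def field_simps)
        then show ?thesis by (simp add: sum_divide_distrib sum_negf)
      qed
      also have "\<dots> \<in> rat_span.span T"
      proof (intro rat_span.span_sum)
        fix i assume "i \<in> {..<N}"
        then have *: "x ^ (i + (n - N)) \<in> rat_span.span T" using False by (intro less) auto
        have "- (coeff p i / coeff p N) \<in> \<rat>" using p(1) by auto
        then obtain q where "- (coeff p i / coeff p N) = of_rat q" by (elim Rats_cases)
        then show "- (coeff p i / coeff p N) * x ^ (i + (n - N)) \<in> rat_span.span T"
          using rat_span.span_scale[OF *, of q] by simp
      qed
      finally show ?thesis .
    qed
  qed
  moreover have "finite T" by (simp add: T_def)
  ultimately show ?thesis using that by blast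
qed

text \<open>More than \<open>card T\<close> elements in the span of \<open>T\<close> are dependent,
  and a dependence among powers of \<open>x\<close> is a rational polynomial with root
  \<open>x\<close>. If powers repeat, \<open>x ^ n = x ^ m\<close> is already such an
  equation.\<close>

lemma algebraic_if_powers_in_finite_span:
  fixes x :: "'a::field_char_0"
  assumes "finite T" "\<And>n. x ^ n \<in> rat_span.span T"
  shows "algebraic x"
proof (cases "inj (\<lambda>n. x ^ n)")
  case False
  then obtain m n where mn: "m \<noteq> n" "x ^ m = x ^ n" by (auto simp: inj_def)
  show ?thesis
  proof (rule algebraicI)
    show "coeff (monom 1 n - monom 1 m :: 'a poly) i \<in> \<int>" for i by simp
    have "coeff (monom 1 n - monom 1 m :: 'a poly) n \<noteq> 0" using mn by simp
    then show "(monom 1 n - monom 1 m :: 'a poly) \<noteq> 0" by fastforce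
    show "poly (monom 1 n - monom 1 m) x = 0" using mn by (simp add: poly_monom)
  qed
next
  case inj: True
  define S where "S = (\<lambda>n. x ^ n) ` {..card T}"
  have "card S = card T + 1"
    unfolding S_def by (subst card_image) (use inj in \<open>auto intro: inj_on_subset\<close>)
  moreover have "S \<subseteq> rat_span.span T" using assms(2) by (auto simp: S_def)
  ultimately have "rat_span.dependent S"
    using rat_span.independent_span_bound[OF assms(1), of S] by auto
  then obtain u v where u: "(\<Sum>v\<in>S. of_rat (u v) * v) = 0" and v: "v \<in> S" "u v \<noteq> 0"
    using rat_span.dependent_finite[of S] by (auto simp: S_def)
  define p where "p = (\<Sum>n\<le>card T. monom (of_rat (u (x ^ n)) :: 'a) n)"
  have coeff_p: "coeff p i = (if i \<le> card T then of_rat (u (x ^ i)) else 0)" for i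
    by (simp add: p_def coeff_sum)
  show ?thesis
  proof (rule algebraicI')
    show "coeff p i \<in> \<rat>" for i by (simp add: coeff_p)
    obtain n where "n \<le> card T" "v = x ^ n" using v by (auto simp: S_def)
    then have "coeff p n \<noteq> 0" using v by (simp add: coeff_p)
    then show "p \<noteq> 0" by auto
    have "poly p x = (\<Sum>n\<le>card T. of_rat (u (x ^ n)) * x ^ n)"
      by (simp add: p_def poly_sum poly_monom)
    also have "\<dots> = (\<Sum>v\<in>S. of_rat (u v) * v)"
      unfolding S_def
      by (subst sum.reindex) (use inj in \<open>auto intro: inj_on_subset\<close>)
    finally show "poly p x = 0" using u by simp
  qed
qed

text \<open>If finite sets \<open>A\<close> and \<open>B\<close> span the powers of \<open>x\<close>
  and \<open>y\<close>, the products \<open>a * b\<close> span all \<open>x ^ m * y ^ n\<close>,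
  hence the powers of the product and, by the binomial theorem, of the sum.\<close>

lemma
  fixes x y :: "'a::field_char_0"
  assumes "algebraic x" "algebraic y"
  shows algebraic_add: "algebraic (x + y)" and algebraic_mult: "algebraic (x * y)"
proof -
  obtain A where A: "finite A" "\<And>n. x ^ n \<in> rat_span.span A"
    using algebraic_imp_powers_in_finite_span[OF assms(1)] by blast
  obtain B where B: "finite B" "\<And>n. y ^ n \<in> rat_span.span B"
    using algebraic_imp_powers_in_finite_span[OF assms(2)] by blast
  define T where "T = {a * b |a b. a \<in> A \<and> b \<in> B}"
  have "finite T" unfolding T_def using finite_image_set2[of "\<lambda>a. a \<in> A" "\<lambda>b. b \<in> B" "(*)"] A(1) B(1) by simp
  have *: "x ^ m * y ^ n \<in> rat_span.span T" for m n
    unfolding T_def by (intro rat_span_mult A B)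
  have "(x + y) ^ n \<in> rat_span.span T" for n
  proof -
    have "of_rat (of_nat (n choose k)) * (x ^ k * y ^ (n - k)) \<in> rat_span.span T" for k
      by (intro rat_span.span_scale *)
    then show ?thesis by (auto simp: binomial_ring mult.assoc intro: rat_span.span_sum)
  qed
  with \<open>finite T\<close> show "algebraic (x + y)" by (rule algebraic_if_powers_in_finite_span)
  have "(x * y) ^ n \<in> rat_span.span T" for n using *[of n n] by (simp add: power_mult_distrib)
  with \<open>finite T\<close> show "algebraic (x * y)" by (rule algebraic_if_powers_in_finite_span)
qed

lemma algebraic_diff: "algebraic x \<Longrightarrow> algebraic y \<Longrightarrow> algebraic (x - y)"
  using algebraic_add[of x "- y"] by simp

lemma algebraic_divide: "algebraic x \<Longrightarrow> algebraic y \<Longrightarrow> algebraic (x / y)"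
  by (auto simp: divide_inverse intro: algebraic_mult)

lemma algebraic_power: "algebraic x \<Longrightarrow> algebraic (x ^ n)"
  by (induction n) (auto intro: algebraic_mult)

lemma algebraic_sum: "(\<And>i. i \<in> I \<Longrightarrow> algebraic (f i)) \<Longrightarrow> algebraic (sum f I)"
  by (induction I rule: infinite_finite_induct) (auto intro: algebraic_add)

lemma algebraic_norm:
  fixes z :: complex
  assumes "algebraic z"
  shows "algebraic (norm z)"
proof -
  have "algebraic ((norm z)\<^sup>2)"
    using algebraic_mult[OF assms algebraic_cnj[OF assms]]
    by (metis algebraic_of_real_iff complex_norm_square)
  then have "algebraic (sqrt ((norm z)\<^sup>2))" by (rule algebraic_sqrt)
  then show ?thesis by simp
qed

lemma countable_algebraic: "countable {x::complex. algebraic x}"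
proof -
  \<comment> \<open>Lists of integers form a countable index set. The zero polynomial gets no roots
    here, as its root set would be uncountable.\<close>
  define R :: "int list \<Rightarrow> complex set" where
    "R cs = (let p = map_poly of_int (Poly cs) in if p = 0 then {} else {x. poly p x = 0})" for cs
  have "{x. algebraic x} \<subseteq> (\<Union>cs. R cs)"
  proof
    fix x :: complex assume "x \<in> {x. algebraic x}"
    then obtain p :: "int poly" where "p \<noteq> 0" "poly (map_poly of_int p) x = 0"
      by (auto elim: algebraicE')
    then have "x \<in> R (coeffs p)" by (simp add: R_def map_poly_eq_0_iff)
    then show "x \<in> (\<Union>cs. R cs)" by blast
  qed
  moreover have "countable (\<Union>cs. R cs)"
    by (intro countable_UN) (auto intro: countable_finite simp: R_def Let_def poly_roots_finite)
  ultimately show ?thesis by (rule countable_subset)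
qed

section \<open>Polynomials with coefficients in \<open>D_lambda\<close> and prescribed zeros\<close>

lemma D_lambda_0 [simp]: "0 \<in> D_lambda l"
  by (simp add: D_lambda_def)

lemma D_lambda_1 [simp]: "1 \<in> D_lambda l"
  by (auto simp: D_lambda_def intro: exI[of _ 0])

lemma D_lambda_algebraic: "x \<in> D_lambda l \<Longrightarrow> algebraic x"
  by (auto simp: D_lambda_def)

lemma D_lambda_uminus: "x \<in> D_lambda l \<Longrightarrow> - x \<in> D_lambda l"
  by (auto simp: D_lambda_def)

lemma D_lambda_mult:
  assumes "x \<in> D_lambda l" "y \<in> D_lambda l"
  shows "x * y \<in> D_lambda l"
proof (cases "x = 0 \<or> y = 0")
  case False
  with assms obtain m n where "norm x = l ^ m" "norm y = l ^ n" "algebraic x" "algebraic y"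
    by (auto simp: D_lambda_def)
  then have "norm (x * y) = l ^ (m + n)" "algebraic (x * y)"
    by (auto simp: norm_mult power_add intro: algebraic_mult)
  then show ?thesis unfolding D_lambda_def by blast
qed auto

lemma D_lambda_norm_ge_1: "x \<in> D_lambda l \<Longrightarrow> x \<noteq> 0 \<Longrightarrow> l > 1 \<Longrightarrow> norm x \<ge> 1"
  by (auto simp: D_lambda_def one_le_power)

lemma D_lambda_unit_times_power:
  assumes "algebraic l" "l > 0" "algebraic u" "norm u = 1"
  shows "of_real (l ^ m) * u \<in> D_lambda l"
proof -
  have "norm (of_real (l ^ m) * u) = l ^ m" using assms by (simp add: norm_mult norm_power)
  moreover have "algebraic (of_real (l ^ m) * u)"
    using assms by (intro algebraic_mult algebraic_of_real algebraic_power)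
  ultimately show ?thesis unfolding D_lambda_def by blast
qed

text \<open>Law of cosines: \<open>x\<close> is the cosine of the angle between the sides of length
  \<open>A\<close> and \<open>C\<close>, and the triangle inequalities put it in
  \<open>[-1, 1]\<close>. The sine is a square root, so \<open>u\<close> is algebraic, and
  \<open>v\<close> is then forced.\<close>

lemma ex_triangle_algebraic:
  fixes A B C :: real
  assumes "A > 0" "B > 0" "C > 0" "\<bar>A - B\<bar> \<le> C" "C \<le> A + B"
    and alg: "algebraic A" "algebraic B" "algebraic C"
  obtains u v :: complex
    where "algebraic u" "algebraic v" "norm u = 1" "norm v = 1"
      "of_real A * u + of_real B * v = of_real C"
proof -
  define x where "x = (A\<^sup>2 + C\<^sup>2 - B\<^sup>2) / (2 * A * C)"
  define u where "u = Complex x (sqrt (1 - x\<^sup>2))"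
  define v where "v = (of_real C - of_real A * u) / of_real B"
  have pos: "2 * A * C > 0" using assms by simp
  have x: "2 * A * C * x = A\<^sup>2 + C\<^sup>2 - B\<^sup>2" using assms by (simp add: x_def)
  \<comment> \<open>The product is \<open>B^2 - (A - C)^2 = 2 * A * C * (1 - x)\<close>; the one for
    \<open>1 + x\<close> below is \<open>(A + C)^2 - B^2\<close>.\<close>
  have "0 \<le> (B - (A - C)) * (B + (A - C))" using assms by (intro mult_nonneg_nonneg) auto
  then have "0 \<le> (2 * A * C) * (1 - x)" using x by (simp add: algebra_simps power2_eq_square)
  then have "0 \<le> 1 - x" using mult_pos_neg[OF pos] by (meson not_le)
  have "0 \<le> (A + C - B) * (A + C + B)" using assms by (intro mult_nonneg_nonneg) auto
  then have "0 \<le> (2 * A * C) * (1 + x)" using x by (simp add: algebra_simps power2_eq_square)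
  then have "0 \<le> 1 + x" using mult_pos_neg[OF pos] by (meson not_le)
  with \<open>0 \<le> 1 - x\<close> have x2: "x\<^sup>2 \<le> 1" by (simp add: abs_square_le_1)
  have nu: "norm u = 1" using x2 by (simp add: u_def cmod_def)
  have "algebraic x"
    unfolding x_def using alg
    by (intro algebraic_divide algebraic_diff algebraic_add algebraic_mult algebraic_power) auto
  then have "algebraic (of_real x + \<i> * of_real (sqrt (1 - x\<^sup>2)))"
    by (intro algebraic_add algebraic_mult algebraic_of_real algebraic_sqrt algebraic_diff
        algebraic_power) auto
  then have au: "algebraic u" by (simp add: u_def Complex_eq)
  have av: "algebraic v" unfolding v_def using alg au
    by (intro algebraic_divide algebraic_diff algebraic_mult) auto
  have "(norm (of_real C - of_real A * u))\<^sup>2 = (C - A * x)\<^sup>2 + A\<^sup>2 * (1 - x\<^sup>2)"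
    using x2 by (simp add: cmod_power2 u_def power_mult_distrib)
  also have "\<dots> = B\<^sup>2" using x by (simp add: algebra_simps power2_eq_square)
  finally have "norm (of_real C - of_real A * u) = B" using assms by (simp add: power2_eq_iff_nonneg)
  then have nv: "norm v = 1" using assms by (simp add: v_def norm_divide)
  show ?thesis
    by (rule that[of u v]) (use nu nv au av assms in \<open>auto simp: v_def\<close>)
qed

text \<open>The least exponent that lifts \<open>x\<close> to 1 overshoots by at most a factor
  \<open>l\<close>.\<close>

lemma ex_power_mult_between:
  fixes l x :: real
  assumes "l > 1" "0 < x" "x \<le> 1"
  obtains m where "1 \<le> l ^ m * x" "l ^ m * x \<le> l"
proof -
  define m where "m = (LEAST m. 1 \<le> l ^ m * x)"
  obtain m0 where "1 / x < l ^ m0" using real_arch_pow[OF assms(1)] by blast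
  then have "1 \<le> l ^ m0 * x" using assms by (simp add: field_simps)
  then have m: "1 \<le> l ^ m * x" unfolding m_def by (rule LeastI)
  have "l ^ m * x \<le> l"
  proof (cases m)
    case 0
    then show ?thesis using assms by simp
  next
    case (Suc k)
    then have "\<not> 1 \<le> l ^ k * x" using not_less_Least[of k "\<lambda>m. 1 \<le> l ^ m * x"] m_def by simp
    then have "l * (l ^ k * x) \<le> l * 1" using assms by (intro mult_left_mono) auto
    then show ?thesis using Suc by simp
  qed
  with m show ?thesis by (rule that)
qed

text \<open>Bolzano-Weierstrass: a convergent subsequence is Cauchy. The condition
  \<open>0 < i\<close> keeps 0, \<open>i\<close> and \<open>j\<close> distinct, so that they can be
  the exponents of three separate monomials.\<close>

lemma ex_close_terms:
  fixes f :: "nat \<Rightarrow> real"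
  assumes "\<And>k. a \<le> f k" "\<And>k. f k \<le> b" "e > 0"
  obtains i j where "0 < i" "i < j" "\<bar>f i - f j\<bar> \<le> e"
proof -
  have "seq_compact {a..b}" by (intro compact_imp_seq_compact) auto
  moreover have "\<forall>n. f n \<in> {a..b}" using assms by auto
  ultimately obtain s c where s: "strict_mono s" "(f \<circ> s) \<longlonglongrightarrow> c"
    unfolding seq_compact_def by blast
  then have "Cauchy (f \<circ> s)" by (intro LIMSEQ_imp_Cauchy)
  then obtain M where M: "\<And>m n. m \<ge> M \<Longrightarrow> n \<ge> M \<Longrightarrow> dist ((f \<circ> s) m) ((f \<circ> s) n) < e"
    using assms(3) unfolding Cauchy_def by blast
  show ?thesis
  proof (rule that)
    have "s (Suc M) \<ge> Suc M" by (rule seq_suble[OF s(1)])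
    then show "0 < s (Suc M)" by simp
    show "s (Suc M) < s (Suc (Suc M))" using s(1) by (simp add: strict_mono_def)
    show "\<bar>f (s (Suc M)) - f (s (Suc (Suc M)))\<bar> \<le> e"
      using M[of "Suc M" "Suc (Suc M)"] by (simp add: dist_real_def)
  qed
qed

text \<open>
  Choosing \<open>m\<^sub>k\<close> with \<open>l ^ m\<^sub>k * \<bar>b\<bar> ^ k \<in> [1, l]\<close>, two of these lengths with positive index are so
  close to each other that, scaled by \<open>l\<close>, they form a triangle with the length for \<open>k = 0\<close>.
\<close>

lemma ex_poly_D_lambda_root:
  fixes b :: complex
  assumes "algebraic l" "l > 1" "algebraic b" "norm b < 1"
  obtains A where "A \<noteq> 0" "\<And>k. coeff A k \<in> D_lambda l" "poly A b = 0"
proof (cases "b = 0")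
  case True
  show ?thesis
    by (rule that[of "[:0, 1:]"]) (use True in \<open>auto simp: coeff_pCons split: nat.splits\<close>)
next
  case False
  define r where "r = norm b"
  have r: "0 < r" "r < 1" using False assms by (auto simp: r_def)
  have ar: "algebraic r" using assms by (simp add: r_def algebraic_norm)
  have "\<exists>m. 1 \<le> l ^ m * r ^ k \<and> l ^ m * r ^ k \<le> l" for k
    using ex_power_mult_between[of l "r ^ k"] assms r by (auto simp: power_le_one)
  then obtain m where m: "\<And>k. 1 \<le> l ^ m k * r ^ k" "\<And>k. l ^ m k * r ^ k \<le> l" by metis
  define f where "f k = l ^ m k * r ^ k" for k
  have f: "1 \<le> f k" "f k \<le> l" "algebraic (f k)" for k
    unfolding f_def using m ar assms by (auto intro: algebraic_mult algebraic_power)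
  \<comment> \<open>With tolerance \<open>1 / l\<close>, the lengths scaled by \<open>l\<close>
    differ by at most 1, hence by at most \<open>f 0\<close>; their sum is at least
    \<open>2 * l\<close>, while \<open>f 0\<close> is at most \<open>l\<close>.\<close>
  obtain i j where ij: "0 < i" "i < j" "\<bar>f i - f j\<bar> \<le> 1 / l"
    using ex_close_terms[of 1 f l "1 / l"] f assms by auto
  have "\<bar>l * f i - l * f j\<bar> = l * \<bar>f i - f j\<bar>"
    using assms by (simp add: abs_mult flip: right_diff_distrib)
  also have "\<dots> \<le> l * (1 / l)" using ij assms by (intro mult_left_mono) auto
  also have "\<dots> \<le> f 0" using f assms by simp
  finally have lower: "\<bar>l * f i - l * f j\<bar> \<le> f 0" .
  have "l * 1 \<le> l * f i" "l * 1 \<le> l * f j" using f assms by (auto intro: mult_left_mono)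
  then have upper: "f 0 \<le> l * f i + l * f j" using f(2)[of 0] assms by linarith
  have pos: "f k > 0" for k using f(1)[of k] by linarith
  obtain u v :: complex where uv: "algebraic u" "algebraic v" "norm u = 1" "norm v = 1"
      "of_real (l * f i) * u + of_real (l * f j) * v = of_real (f 0)"
    using ex_triangle_algebraic[OF _ _ _ lower upper] pos f assms
    by (auto simp: algebraic_mult)
  \<comment> \<open>\<open>w\<close> rotates \<open>b\<close> to the positive real axis, so the
    factor \<open>w ^ k\<close> in \<open>c k t\<close> cancels the argument of
    \<open>b ^ k\<close>. The exponent \<open>m k + 1\<close> contains the scaling by
    \<open>l\<close>, and \<open>A\<close> is the triangle relation read as a polynomial in
    \<open>b\<close>.\<close>
  define w where "w = of_real r / b"
  have w: "algebraic w" "norm w = 1" "w * b = of_real r"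
    using ar assms False by (auto simp: w_def r_def norm_divide intro: algebraic_divide algebraic_of_real)
  define c where "c k t = of_real (l ^ (m k + 1)) * (w ^ k * t)" for k and t :: complex
  have c: "c k t \<in> D_lambda l" if "algebraic t" "norm t = 1" for k t
    unfolding c_def using assms w that
    by (intro D_lambda_unit_times_power) (auto simp: norm_mult norm_power intro: algebraic_mult algebraic_power)
  have cb: "c k t * b ^ k = of_real (l * f k) * t" for k t
  proof -
    have "c k t * b ^ k = of_real (l ^ (m k + 1)) * (w * b) ^ k * t"
      by (simp add: c_def power_mult_distrib)
    then show ?thesis by (simp add: w f_def)
  qed
  define A where "A = monom (of_real (f 0)) 0 + monom (- c i u) i + monom (- c j v) j"
  have "f 0 = l ^ m 0" by (simp add: f_def)
  then have f0: "of_real (f 0) \<in> D_lambda l"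
    using D_lambda_unit_times_power[of l 1 "m 0"] assms by simp
  show ?thesis
  proof (rule that[of A])
    have "coeff A 0 \<noteq> 0" using ij pos[of 0] by (simp add: A_def)
    then show "A \<noteq> 0" by auto
    show "coeff A k \<in> D_lambda l" for k
      using f0 c uv ij by (auto simp: A_def D_lambda_uminus)
    have "poly A b = of_real (f 0) - c i u * b ^ i - c j v * b ^ j"
      by (simp add: A_def poly_monom)
    also have "\<dots> = of_real (f 0) - (of_real (l * f i) * u + of_real (l * f j) * v)"
      unfolding cb by (rule diff_diff_eq)
    also have "\<dots> = 0" unfolding uv(5) by (rule diff_self)
    finally show "poly A b = 0" .
  qed
qed

text \<open>The shifted copies of \<open>P\<close> do not overlap because
  \<open>degree P < N\<close>. Each coefficient is thus one product and no sum, so closure under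
  multiplication is enough to stay in \<open>D_lambda l\<close>.\<close>

lemma coeff_mult_pcompose_monom:
  fixes P A :: "'a::comm_ring_1 poly"
  assumes "degree P < N"
  shows "coeff (P * pcompose A (monom 1 N)) k = coeff P (k mod N) * coeff A (k div N)"
proof (induction A arbitrary: k)
  case (pCons a A)
  have "P * pcompose (pCons a A) (monom 1 N) =
      smult a P + monom 1 N * (P * pcompose A (monom 1 N))"
    by (simp add: pcompose_pCons algebra_simps)
  then have *: "coeff (P * pcompose (pCons a A) (monom 1 N)) k =
      a * coeff P k + (if k < N then 0 else coeff (P * pcompose A (monom 1 N)) (k - N))"
    by (simp add: coeff_monom_mult)
  show ?case
  proof (cases "k < N")
    case True
    then show ?thesis by (simp add: *)
  next
    case False
    then have "coeff P k = 0" using assms by (intro coeff_eq_0) auto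
    then show ?thesis using False assms pCons
      by (simp add: * le_mod_geq le_div_geq)
  qed
qed simp

text \<open>The new zero belongs to the cofactor \<open>R\<close>, so repeated use accumulates
  multiplicity at \<open>b\<close>, while \<open>P * R\<close> keeps all zeros of
  \<open>P\<close>.\<close>

lemma ex_multiple_D_lambda_root:
  fixes b :: complex
  assumes "algebraic l" "l > 1" "algebraic b" "norm b < 1"
    and P: "P \<noteq> 0" "\<And>k. coeff P k \<in> D_lambda l"
  obtains R where "R \<noteq> 0" "\<And>k. coeff (P * R) k \<in> D_lambda l" "[:- b, 1:] dvd R"
proof -
  define N where "N = degree P + 1"
  have "norm (b ^ N) < 1" using assms by (simp add: norm_power N_def power_less_one_iff del: power_Suc)
  then obtain A where A: "A \<noteq> 0" "\<And>k. coeff A k \<in> D_lambda l" "poly A (b ^ N) = 0"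
    using ex_poly_D_lambda_root[OF assms(1,2) algebraic_power[OF assms(3), of N]] by blast
  show ?thesis
  proof (rule that)
    show "pcompose A (monom 1 N) \<noteq> 0"
      using A(1) by (simp add: pcompose_eq_0_iff degree_monom_eq N_def)
    show "coeff (P * pcompose A (monom 1 N)) k \<in> D_lambda l" for k
      by (simp add: coeff_mult_pcompose_monom N_def D_lambda_mult A P)
    show "[:- b, 1:] dvd pcompose A (monom 1 N)"
      using A(3) by (simp add: poly_eq_0_iff_dvd[symmetric] poly_pcompose poly_monom)
  qed
qed

lemma ex_poly_D_lambda_roots:
  assumes "algebraic l" "l > 1" "finite B" "\<And>b. b \<in> B \<Longrightarrow> algebraic b \<and> norm b < 1"
  shows "\<exists>P. P \<noteq> 0 \<and> (\<forall>k. coeff P k \<in> D_lambda l) \<and> (\<forall>b\<in>B. [:- b, 1:] ^ n dvd P)"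
  using assms(3,4)
proof (induction B rule: finite_induct)
  case empty
  show ?case by (rule exI[of _ 1]) simp
next
  case (insert b B)
  then obtain P where P: "P \<noteq> 0" "\<And>k. coeff P k \<in> D_lambda l" "\<And>b. b \<in> B \<Longrightarrow> [:- b, 1:] ^ n dvd P"
    by auto
  have "\<exists>R. R \<noteq> 0 \<and> (\<forall>k. coeff (P * R) k \<in> D_lambda l) \<and> [:- b, 1:] ^ m dvd R" for m
  proof (induction m)
    case 0
    show ?case by (rule exI[of _ 1]) (simp add: P)
  next
    case (Suc m)
    then obtain R where R: "R \<noteq> 0" "\<And>k. coeff (P * R) k \<in> D_lambda l" "[:- b, 1:] ^ m dvd R"
      by auto
    obtain Q where Q: "Q \<noteq> 0" "\<And>k. coeff (P * R * Q) k \<in> D_lambda l" "[:- b, 1:] dvd Q"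
      using ex_multiple_D_lambda_root[OF assms(1,2), of b "P * R"] insert.prems P(1) R by auto
    show ?case
      by (rule exI[of _ "R * Q"])
        (use R Q in \<open>auto simp: mult.assoc mult.commute[of "[:- b, 1:]"] intro: mult_dvd_mono simp del: mult_pCons_right mult_pCons_left\<close>)
  qed
  from this[of n] obtain R where "R \<noteq> 0" "\<And>k. coeff (P * R) k \<in> D_lambda l" "[:- b, 1:] ^ n dvd R"
    by auto
  with P show ?case by (intro exI[of _ "P * R"]) auto
qed

section \<open>Transcendence of lacunary power series\<close>

lemma fps_nth_mult_cong_upto:
  fixes F G F' G' :: "'a::comm_semiring_1 fps"
  assumes "\<And>k. k \<le> K \<Longrightarrow> fps_nth F k = fps_nth F' k" "\<And>k. k \<le> K \<Longrightarrow> fps_nth G k = fps_nth G' k"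
  shows "k \<le> K \<Longrightarrow> fps_nth (F * G) k = fps_nth (F' * G') k"
  using assms by (auto simp: fps_mult_nth intro!: sum.cong)

lemma fps_nth_power_cong_upto:
  fixes F F' :: "'a::comm_semiring_1 fps"
  assumes "\<And>k. k \<le> K \<Longrightarrow> fps_nth F k = fps_nth F' k"
  shows "k \<le> K \<Longrightarrow> fps_nth (F ^ n) k = fps_nth (F' ^ n) k"
proof (induction n arbitrary: k)
  case (Suc n)
  then show ?case unfolding power_Suc
    by (intro fps_nth_mult_cong_upto[OF assms]) auto
qed simp

text \<open>
  If \<open>P(z, F) = 0\<close> and the truncation \<open>T n\<close> of \<open>F\<close> is followed by a long gap, then the polynomial
  \<open>P(z, T n)\<close> vanishes to an order larger than its degree. Hence all the \<open>T n\<close> are roots of \<open>P\<close>.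
\<close>

lemma fps_with_gaps_transcendental:
  fixes F :: "'a::idom fps" and T :: "nat \<Rightarrow> 'a poly" and P :: "'a poly poly"
  assumes inj: "inj_on T {n0..}"
    and gap: "\<And>n k. n \<ge> n0 \<Longrightarrow> k \<le> n * (degree (T n) + 1) \<Longrightarrow> fps_nth F k = coeff (T n) k"
    and root: "(\<Sum>i\<le>degree P. fps_of_poly (coeff P i) * F ^ i) = 0"
  shows "P = 0"
proof (rule ccontr)
  assume "P \<noteq> 0"
  \<comment> \<open>\<open>P(z, T n)\<close> has degree at most
    \<open>M + degree P * degree (T n)\<close>, which for \<open>n \<ge> M + degree P\<close> stays
    inside the range where \<open>F\<close> and \<open>T n\<close> agree.\<close>
  define M where "M = (\<Sum>i\<le>degree P. degree (coeff P i))"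
  define n1 where "n1 = max n0 (M + degree P)"
  have "poly P (T n) = 0" if n: "n \<ge> n1" for n
  proof -
    define K where "K = n * (degree (T n) + 1)"
    have deg: "degree (poly P (T n)) \<le> K"
      unfolding poly_altdef
    proof (rule degree_sum_le)
      fix i assume i: "i \<in> {..degree P}"
      have "degree (coeff P i * T n ^ i) \<le> degree (coeff P i) + degree (T n) * i"
        by (metis degree_mult_le degree_power_le add_left_mono order_trans)
      also have "degree (coeff P i) \<le> M"
        unfolding M_def using i by (intro member_le_sum) auto
      also have "degree (T n) * i \<le> degree (T n) * degree P" using i by simp
      also have "M + degree (T n) * degree P \<le> (M + degree P) * (degree (T n) + 1)"
        by (simp add: algebra_simps)
      also have "\<dots> \<le> K" unfolding K_def using n by (intro mult_right_mono) (auto simp: n1_def)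
      finally show "degree (coeff P i * T n ^ i) \<le> K" by simp
    qed simp
    have "coeff (poly P (T n)) k = 0" if k: "k \<le> K" for k
    proof -
      have "coeff (poly P (T n)) k =
          (\<Sum>i\<le>degree P. fps_nth (fps_of_poly (coeff P i) * fps_of_poly (T n) ^ i) k)"
        by (simp add: poly_altdef coeff_sum flip: fps_of_poly_mult fps_of_poly_power)
      also have "\<dots> = (\<Sum>i\<le>degree P. fps_nth (fps_of_poly (coeff P i) * F ^ i) k)"
      proof (rule sum.cong[OF refl])
        fix i
        have "fps_nth (fps_of_poly (T n)) j = fps_nth F j" if "j \<le> K" for j
          using gap[of n j] n that by (simp add: K_def n1_def)
        then show "fps_nth (fps_of_poly (coeff P i) * fps_of_poly (T n) ^ i) k =
            fps_nth (fps_of_poly (coeff P i) * F ^ i) k"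
          by (intro fps_nth_mult_cong_upto[OF refl _ k] fps_nth_power_cong_upto) auto
      qed
      also have "\<dots> = fps_nth (\<Sum>i\<le>degree P. fps_of_poly (coeff P i) * F ^ i) k"
        by (simp add: fps_sum_nth)
      finally show ?thesis by (simp add: root)
    qed
    moreover have "coeff (poly P (T n)) k = 0" if "k > K" for k
      using deg that by (intro coeff_eq_0) auto
    ultimately show ?thesis by (intro poly_eqI) (metis coeff_0 not_le)
  qed
  \<comment> \<open>A nonzero polynomial over an integral domain has finitely many roots, but
    injectivity provides infinitely many \<open>T n\<close>.\<close>
  then have "T ` {n1..} \<subseteq> {x. poly P x = 0}" by auto
  then have "finite (T ` {n1..})" using poly_roots_finite[OF \<open>P \<noteq> 0\<close>] by (rule finite_subset)
  moreover have "inj_on T {n1..}" by (rule inj_on_subset[OF inj]) (auto simp: n1_def)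
  ultimately have "finite {n1..}" by (rule finite_imageD)
  then show False using infinite_Ici by blast
qed

lemma transcendental_over_ratfuns_on_cong:
  assumes "\<And>z. z \<in> U \<Longrightarrow> f z = g z"
  shows "transcendental_over_ratfuns_on U f \<longleftrightarrow> transcendental_over_ratfuns_on U g"
  unfolding transcendental_over_ratfuns_on_def using assms by auto

text \<open>Clearing denominators gives a polynomial relation on the whole disk; uniqueness of the
  expansion at 0 turns it into a formal identity, to which \<open>transc\<close> applies.\<close>

lemma transcendental_over_ratfuns_on_eval_fps:
  fixes F :: "complex fps"
  assumes "r > 0" "fps_conv_radius F > 0"
    and transc: "\<And>P :: complex poly poly.
      (\<Sum>i\<le>degree P. fps_of_poly (coeff P i) * F ^ i) = 0 \<Longrightarrow> P = 0"
  shows "transcendental_over_ratfuns_on (ball 0 r) (eval_fps F)"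
  unfolding transcendental_over_ratfuns_on_def
proof (safe)
  fix P :: "complex poly fract poly"
  assume "P \<noteq> 0" and id: "\<forall>z\<in>ball 0 r. (\<forall>i. \<not> ratfun_pole (coeff P i) z) \<longrightarrow>
     (\<Sum>i\<le>degree P. ratfun_eval (coeff P i) z * eval_fps F z ^ i) = 0"
  define m where "m = degree P"
  define num where "num i = fst (quot_of_fract (coeff P i))" for i
  define den where "den i = snd (quot_of_fract (coeff P i))" for i
  define D where "D = (\<Prod>i\<le>m. den i)"
  define E where "E i = (\<Prod>j\<in>{..m} - {i}. den j)" for i
  have den_nz: "den i \<noteq> 0" for i by (simp add: den_def)
  have DE: "D = den i * E i" if "i \<le> m" for i
    unfolding D_def E_def using that by (intro prod.remove) auto
  text \<open>The additional factor \<open>D\<close> makes the cleared identity trivial at the poles.\<close>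
  define Q where "Q = (\<Sum>i\<le>m. monom (D * E i * num i) i)"
  have coeff_Q: "coeff Q i = (if i \<le> m then D * E i * num i else 0)" for i
    by (simp add: Q_def coeff_sum)
  have "num m \<noteq> 0" using \<open>P \<noteq> 0\<close> by (simp add: num_def m_def)
  moreover have "D \<noteq> 0" "E m \<noteq> 0" using den_nz by (auto simp: D_def E_def)
  ultimately have Qm: "coeff Q m \<noteq> 0" by (simp add: coeff_Q)
  have "degree Q = m"
    by (intro antisym le_degree[OF Qm] degree_le) (auto simp: coeff_Q)
  have zero: "(\<Sum>i\<le>m. poly (coeff Q i) z * eval_fps F z ^ i) = 0" if z: "z \<in> ball 0 r" for z
  proof (cases "poly D z = 0")
    case True
    then show ?thesis by (simp add: coeff_Q)
  next
    case False
    then have den_z: "poly (den i) z \<noteq> 0" if "i \<le> m" for i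
      using that by (auto simp: DE)
    have "\<not> ratfun_pole (coeff P i) z" for i
    proof (cases "i \<le> m")
      case True
      then show ?thesis using den_z by (simp add: ratfun_pole_def den_def)
    next
      case False
      then show ?thesis by (simp add: ratfun_pole_def m_def coeff_eq_0)
    qed
    \<comment> \<open>One factor \<open>D\<close> cancels the denominators, the other is the one
      built into \<open>Q\<close>.\<close>
    then have "0 = poly D z ^ 2 * (\<Sum>i\<le>m. ratfun_eval (coeff P i) z * eval_fps F z ^ i)"
      using id z by (simp add: m_def)
    also have "\<dots> = (\<Sum>i\<le>m. poly (coeff Q i) z * eval_fps F z ^ i)"
      unfolding sum_distrib_left
    proof (rule sum.cong[OF refl])
      fix i assume "i \<in> {..m}"
      then have i: "i \<le> m" by simp
      have "poly D z ^ 2 * ratfun_eval (coeff P i) z =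
          poly D z * (poly (E i) z * poly (den i) z) * (poly (num i) z / poly (den i) z)"
        by (simp add: power2_eq_square ratfun_eval_def num_def den_def DE[OF i])
      also have "\<dots> = poly (coeff Q i) z" using den_z[OF i] i by (simp add: coeff_Q)
      finally show "poly D z ^ 2 * (ratfun_eval (coeff P i) z * eval_fps F z ^ i) =
          poly (coeff Q i) z * eval_fps F z ^ i" by (simp add: mult.assoc)
    qed
    finally show ?thesis by simp
  qed
  have poly_exp: "poly p has_fps_expansion fps_of_poly p" for p :: "complex poly"
  proof -
    have "eval_fps (fps_of_poly p) = poly p" by (rule ext) simp
    then show ?thesis using eval_fps_has_fps_expansion[of "fps_of_poly p"] by simp
  qed
  have "(\<lambda>z. \<Sum>i\<le>m. poly (coeff Q i) z * eval_fps F z ^ i) has_fps_expansion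
      (\<Sum>i\<le>m. fps_of_poly (coeff Q i) * F ^ i)"
    by (intro fps_expansion_intros poly_exp eval_fps_has_fps_expansion assms)
  moreover have "(\<lambda>z. \<Sum>i\<le>m. poly (coeff Q i) z * eval_fps F z ^ i) has_fps_expansion 0"
    unfolding has_fps_expansion_0_iff eventually_nhds
    by (intro exI[of _ "ball 0 r"]) (use zero assms in auto)
  ultimately have "(\<Sum>i\<le>m. fps_of_poly (coeff Q i) * F ^ i) = 0"
    by (rule fps_expansion_unique_complex)
  then have "Q = 0" using transc[of Q] \<open>degree Q = m\<close> by simp
  then show False using Qm by simp
qed

section \<open>Termwise differentiation\<close>

lemma fps_conv_radius_higher_deriv:
  fixes F :: "'a::{banach,real_normed_field} fps"
  shows "fps_conv_radius ((fps_deriv ^^ s) F) \<ge> fps_conv_radius F"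
  by (induction s) (auto intro: order_trans fps_conv_radius_deriv)

lemma higher_deriv_eval_fps:
  fixes F :: "'a::{banach,real_normed_field} fps"
  assumes "norm z < fps_conv_radius F"
  shows "(deriv ^^ s) (eval_fps F) z = eval_fps ((fps_deriv ^^ s) F) z"
  using assms
proof (induction s arbitrary: z)
  case (Suc s)
  \<comment> \<open>Differentiating the induction hypothesis needs it on a neighbourhood of
    \<open>z\<close>, not only at \<open>z\<close>.\<close>
  have "eventually (\<lambda>w. w \<in> eball 0 (fps_conv_radius F)) (nhds z)"
    using Suc.prems by (intro eventually_nhds_in_open) auto
  then have "eventually (\<lambda>w. (deriv ^^ s) (eval_fps F) w = eval_fps ((fps_deriv ^^ s) F) w) (nhds z)"
    by eventually_elim (simp add: Suc.IH)
  then have "deriv ((deriv ^^ s) (eval_fps F)) z = deriv (eval_fps ((fps_deriv ^^ s) F)) z"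
    by (intro deriv_cong_ev) auto
  also have "\<dots> = eval_fps (fps_deriv ((fps_deriv ^^ s) F)) z"
    by (intro DERIV_imp_deriv has_field_derivative_eval_fps less_le_trans[OF Suc.prems]
        fps_conv_radius_higher_deriv)
  finally show ?case by simp
qed simp

lemma fps_of_poly_higher_pderiv:
  "fps_of_poly ((pderiv ^^ s) p) = (fps_deriv ^^ s) (fps_of_poly p)"
  by (induction s) (auto simp: fps_of_poly_pderiv)

lemma fps_nth_higher_deriv_cong:
  fixes F G :: "'a::comm_semiring_1 fps"
  assumes "\<And>k. k \<le> K + s \<Longrightarrow> fps_nth F k = fps_nth G k" "k \<le> K"
  shows "fps_nth ((fps_deriv ^^ s) F) k = fps_nth ((fps_deriv ^^ s) G) k"
  using assms
proof (induction s arbitrary: K k)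
  case (Suc s)
  have "fps_nth ((fps_deriv ^^ s) F) (k + 1) = fps_nth ((fps_deriv ^^ s) G) (k + 1)"
    by (rule Suc.IH[of "K + 1"]) (use Suc.prems in auto)
  then show ?case by simp
qed simp

text \<open>By the product rule, each derivative lowers the power of \<open>q\<close> by at most
  one.\<close>

lemma power_dvd_higher_pderiv:
  fixes q p :: "'a::idom poly"
  assumes "q ^ (n + s) dvd p"
  shows "q ^ n dvd (pderiv ^^ s) p"
  using assms
proof (induction s arbitrary: n)
  case (Suc s)
  then have "q ^ (Suc n + s) dvd p" by simp
  then have "q ^ Suc n dvd (pderiv ^^ s) p" by (rule Suc.IH)
  then obtain r where r: "(pderiv ^^ s) p = q ^ Suc n * r" ..
  have "pderiv (q ^ Suc n * r) = q ^ n * (q * pderiv r + smult (of_nat (Suc n)) (pderiv q * r))"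
    unfolding pderiv_mult pderiv_power_Suc by (simp add: algebra_simps del: of_nat_Suc)
  then show ?case by (simp add: r del: power_Suc)
qed simp

section \<open>Series of blocks separated by growing gaps\<close>

text \<open>The growing factor \<open>n + 1\<close> makes the gaps outgrow any fixed degree of a
  candidate algebraic relation.\<close>

locale lacunary_blocks =
  fixes B :: "nat \<Rightarrow> complex poly"
  assumes B_nonzero: "B n \<noteq> 0"
    and B_Suc_low: "k \<le> (n + 1) * (degree (B n) + 1) \<Longrightarrow> coeff (B (Suc n)) k = 0"
begin

definition trunc :: "(nat \<Rightarrow> complex) \<Rightarrow> nat \<Rightarrow> complex poly" where
  "trunc c n = (\<Sum>m\<le>n. smult (c m) (B m))"

text \<open>A diagonal limit: blocks with index above \<open>k\<close> have no coefficient at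
  \<open>k\<close>, so \<open>trunc c k\<close> is already final there.\<close>

definition series :: "(nat \<Rightarrow> complex) \<Rightarrow> complex fps" where
  "series c = Abs_fps (\<lambda>k. coeff (trunc c k) k)"

lemma degree_B_Suc: "(n + 1) * (degree (B n) + 1) < degree (B (Suc n))"
  using B_Suc_low[of "degree (B (Suc n))" n] B_nonzero[of "Suc n"] by (meson leading_coeff_0_iff not_le)

lemma strict_mono_degree_B: "strict_mono (\<lambda>n. degree (B n))"
  unfolding strict_mono_Suc_iff
proof
  fix n
  have "degree (B n) \<le> (n + 1) * (degree (B n) + 1)" by simp
  also note degree_B_Suc
  finally show "degree (B n) < degree (B (Suc n))" .
qed

lemma degree_B_ge: "n \<le> degree (B n)"
  using strict_mono_degree_B by (rule seq_suble)

lemma degree_B_less: "m < n \<Longrightarrow> degree (B m) < degree (B n)"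
  using strict_mono_degree_B by (simp add: strict_mono_def)

lemma degree_B_mono: "m \<le> n \<Longrightarrow> degree (B m) \<le> degree (B n)"
  using strict_mono_mono[OF strict_mono_degree_B] by (rule monoD)

lemma coeff_B_low:
  assumes "n < m" "k \<le> (n + 1) * (degree (B n) + 1)"
  shows "coeff (B m) k = 0"
proof -
  obtain m' where m: "m = Suc m'" "n \<le> m'" using assms(1) by (cases m) auto
  have "(n + 1) * (degree (B n) + 1) \<le> (m' + 1) * (degree (B m') + 1)"
    using degree_B_mono[OF m(2)] m(2) by (intro mult_mono) auto
  with assms(2) show ?thesis unfolding m(1) by (intro B_Suc_low) simp
qed

text \<open>A block ends before any later one starts. Hence no two blocks are added at one index,
  which lets a series of signed blocks keep its coefficients in \<open>D_lambda l\<close>.\<close>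

lemma coeff_B_unique:
  assumes "coeff (B m) k \<noteq> 0" "coeff (B n) k \<noteq> 0"
  shows "m = n"
proof -
  have *: "\<not> i < j" if "coeff (B i) k \<noteq> 0" "coeff (B j) k \<noteq> 0" for i j
  proof
    assume "i < j"
    have "k \<le> degree (B i)" using that by (intro le_degree)
    also have "\<dots> \<le> (i + 1) * (degree (B i) + 1)" by simp
    finally have "coeff (B j) k = 0" using \<open>i < j\<close> by (intro coeff_B_low)
    with that show False by simp
  qed
  from *[OF assms] *[OF assms(2,1)] show ?thesis by simp
qed

lemma trunc_Suc: "trunc c (Suc n) = trunc c n + smult (c (Suc n)) (B (Suc n))"
  by (simp add: trunc_def)

lemma coeff_trunc_stable:
  assumes "n \<le> m" "k \<le> (n + 1) * (degree (B n) + 1)"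
  shows "coeff (trunc c m) k = coeff (trunc c n) k"
  using assms(1)
proof (induction m rule: dec_induct)
  case (step m)
  then show ?case using coeff_B_low[of n "Suc m" k] assms(2) by (simp add: trunc_Suc)
qed simp

lemma series_nth:
  assumes "k \<le> (n + 1) * (degree (B n) + 1)"
  shows "fps_nth (series c) k = coeff (trunc c n) k"
proof (cases "n \<le> k")
  case True
  then show ?thesis using coeff_trunc_stable[OF True assms] by (simp add: series_def)
next
  case False
  have "k \<le> (k + 1) * (degree (B k) + 1)" by simp
  then show ?thesis using coeff_trunc_stable[of k n k c] False by (simp add: series_def)
qed

lemma coeff_trunc:
  assumes "coeff (B m) k \<noteq> 0"
  shows "coeff (trunc c n) k = (if m \<le> n then c m * coeff (B m) k else 0)"
proof -
  have "coeff (trunc c n) k = (\<Sum>i\<le>n. if i = m then c m * coeff (B m) k else 0)"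
    unfolding trunc_def coeff_sum
    using coeff_B_unique[OF assms] by (intro sum.cong) auto
  then show ?thesis by simp
qed

lemma series_nth_cases: "fps_nth (series c) k = 0 \<or> (\<exists>m. fps_nth (series c) k = c m * coeff (B m) k)"
proof (cases "\<exists>m. coeff (B m) k \<noteq> 0")
  case True
  then obtain m where "coeff (B m) k \<noteq> 0" ..
  then show ?thesis by (auto simp: series_def coeff_trunc)
next
  case False
  then show ?thesis by (simp add: series_def trunc_def coeff_sum)
qed

lemma series_nth_degree_B: "fps_nth (series c) (degree (B n)) = c n * lead_coeff (B n)"
  using series_nth[of "degree (B n)" n c] coeff_trunc[of n "degree (B n)" c n] B_nonzero by simp

lemma inj_series: "inj series"
proof (rule injI, rule ext)
  fix c d n
  assume "series c = series d"
  then have "c n * lead_coeff (B n) = d n * lead_coeff (B n)" by (metis series_nth_degree_B)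
  then show "c n = d n" using B_nonzero by simp
qed

lemma degree_trunc_le: "degree (trunc c n) \<le> degree (B n)"
  unfolding trunc_def
  by (intro degree_sum_le) (auto intro: order_trans[OF degree_smult_le] degree_B_mono)

lemma degree_trunc:
  assumes "c n \<noteq> 0"
  shows "degree (trunc c n) = degree (B n)"
proof (intro antisym degree_trunc_le le_degree)
  show "coeff (trunc c n) (degree (B n)) \<noteq> 0"
    using coeff_trunc[of n "degree (B n)" c n] B_nonzero assms by simp
qed

lemma series_higher_deriv_nth:
  assumes "k + s \<le> (n + 1) * (degree (B n) + 1)"
  shows "fps_nth ((fps_deriv ^^ s) (series c)) k = coeff ((pderiv ^^ s) (trunc c n)) k"
proof -
  have "fps_nth ((fps_deriv ^^ s) (series c)) k = fps_nth ((fps_deriv ^^ s) (fps_of_poly (trunc c n))) k"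
    by (rule fps_nth_higher_deriv_cong[of k]) (use assms series_nth in auto)
  then show ?thesis by (simp flip: fps_of_poly_higher_pderiv)
qed

text \<open>Nonzero \<open>c n\<close> give the truncations the degrees of the blocks. After
  \<open>s\<close> derivatives these still increase strictly for \<open>n \<ge> s\<close>, so the
  truncations are distinct and the gap criterion applies.\<close>

lemma series_higher_deriv_transcendental:
  assumes "\<And>n. c n \<noteq> 0"
    and "(\<Sum>i\<le>degree P. fps_of_poly (coeff P i) * (fps_deriv ^^ s) (series c) ^ i) = 0"
  shows "P = 0"
proof (rule fps_with_gaps_transcendental)
  let ?T = "\<lambda>n. (pderiv ^^ s) (trunc c n)"
  have deg: "degree (?T n) = degree (B n) - s" for n
    by (simp add: degree_higher_pderiv degree_trunc assms(1))
  show "inj_on ?T {s..}"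
  proof (rule linorder_inj_onI)
    fix m n assume "m < n" "m \<in> {s..}"
    then have "degree (?T m) < degree (?T n)"
      unfolding deg using degree_B_less[of m n] degree_B_ge[of m] by auto
    then show "?T m \<noteq> ?T n" by auto
  qed auto
  show "fps_nth ((fps_deriv ^^ s) (series c)) k = coeff (?T n) k"
    if "n \<ge> s" "k \<le> n * (degree (?T n) + 1)" for n k
  proof (rule series_higher_deriv_nth)
    have "n * (degree (?T n) + 1) \<le> n * (degree (B n) + 1)"
      unfolding deg by (intro mult_left_mono) auto
    then have "k \<le> n * (degree (B n) + 1)" using that by linarith
    \<comment> \<open>The spare summand \<open>degree (B n) + 1\<close> absorbs the shift by
      \<open>s\<close>, since \<open>s \<le> n \<le> degree (B n)\<close>.\<close>
    moreover have "(n + 1) * (degree (B n) + 1) = n * (degree (B n) + 1) + degree (B n) + 1" by simp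
    ultimately show "k + s \<le> (n + 1) * (degree (B n) + 1)"
      using that degree_B_ge[of n] by linarith
  qed
  show "(\<Sum>i\<le>degree P. fps_of_poly (coeff P i) * (fps_deriv ^^ s) (series c) ^ i) = 0" by fact
qed

text \<open>Blocks after \<open>N\<close> vanish at \<open>a\<close> to order above \<open>s\<close>
  and contribute nothing to the \<open>s\<close>-th derivative there. The partial sums cut at the
  degrees of the blocks are eventually constant, and this subsequence determines the limit.\<close>

lemma eval_series_higher_deriv:
  assumes a: "norm a < fps_conv_radius (series c)"
    and dvd: "\<And>n. n > N \<Longrightarrow> [:- a, 1:] ^ Suc s dvd B n"
  shows "eval_fps ((fps_deriv ^^ s) (series c)) a = poly ((pderiv ^^ s) (trunc c N)) a"
proof -
  define F where "F = (fps_deriv ^^ s) (series c)"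
  define T where "T n = (pderiv ^^ s) (trunc c n)" for n
  have T_a: "poly (T n) a = poly (T N) a" if "n \<ge> N" for n
    using that
  proof (induction n rule: dec_induct)
    case (step n)
    have "[:- a, 1:] ^ 1 dvd (pderiv ^^ s) (B (Suc n))"
      using dvd[of "Suc n"] step.hyps by (intro power_dvd_higher_pderiv) simp
    then have "poly ((pderiv ^^ s) (B (Suc n))) a = 0" by (simp add: poly_eq_0_iff_dvd)
    then show ?case using step.IH
      by (simp add: T_def trunc_Suc higher_pderiv_add higher_pderiv_smult)
  qed simp
  have "norm a < fps_conv_radius F"
    unfolding F_def by (rule less_le_trans[OF a fps_conv_radius_higher_deriv])
  then have "(\<lambda>n. \<Sum>k<n. fps_nth F k * a ^ k) \<longlonglongrightarrow> eval_fps F a"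
    using sums_eval_fps unfolding sums_def by blast
  moreover have "strict_mono (\<lambda>n. degree (B n) + 1)"
    using strict_mono_degree_B by (simp add: strict_mono_def)
  ultimately have "((\<lambda>n. \<Sum>k<n. fps_nth F k * a ^ k) \<circ> (\<lambda>n. degree (B n) + 1)) \<longlonglongrightarrow> eval_fps F a"
    by (rule LIMSEQ_subseq_LIMSEQ)
  moreover have "eventually (\<lambda>n. ((\<lambda>n. \<Sum>k<n. fps_nth F k * a ^ k) \<circ> (\<lambda>n. degree (B n) + 1)) n
      = poly (T N) a) sequentially"
    using eventually_ge_at_top[of "max 1 (max s N)"]
  proof eventually_elim
    case (elim n)
    have "fps_nth F k = coeff (T n) k" if "k \<le> degree (B n)" for k
      unfolding F_def T_def
    proof (rule series_higher_deriv_nth)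
      \<comment> \<open>Here \<open>n \<ge> s\<close> gives \<open>s \<le> degree (B n)\<close>, and
        \<open>n \<ge> 1\<close> makes the gap factor at least 2.\<close>
      have "k + s \<le> 2 * (degree (B n) + 1)" using that elim degree_B_ge[of n] by simp
      also have "\<dots> \<le> (n + 1) * (degree (B n) + 1)" using elim by (intro mult_right_mono) auto
      finally show "k + s \<le> (n + 1) * (degree (B n) + 1)" .
    qed
    then have "(\<Sum>k<degree (B n) + 1. fps_nth F k * a ^ k) = (\<Sum>k\<le>degree (B n). coeff (T n) k * a ^ k)"
      by (intro sum.cong) auto
    also have "\<dots> = (\<Sum>k\<le>degree (T n). coeff (T n) k * a ^ k)"
    proof (rule sum.mono_neutral_right)
      have "degree (T n) \<le> degree (B n)"
        unfolding T_def degree_higher_pderiv using degree_trunc_le[of c n] by simp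
      then show "{..degree (T n)} \<subseteq> {..degree (B n)}" by auto
    qed (auto simp: coeff_eq_0)
    also have "\<dots> = poly (T n) a" by (simp add: poly_altdef)
    also have "\<dots> = poly (T N) a" using elim by (intro T_a) simp
    finally show ?case by simp
  qed
  then have "((\<lambda>n. \<Sum>k<n. fps_nth F k * a ^ k) \<circ> (\<lambda>n. degree (B n) + 1)) \<longlonglongrightarrow> poly (T N) a"
    by (rule tendsto_eventually)
  ultimately show ?thesis unfolding F_def T_def by (rule LIMSEQ_unique)
qed

end

text \<open>Comparison with the derivative of the geometric series gives radius at least 1;
  coefficients that do not tend to 0 give radius at most 1.\<close>

lemma conv_radius_eq_1_if_coeffs_between:
  fixes f :: "nat \<Rightarrow> 'a::{banach,real_normed_div_algebra}"
  assumes le: "\<And>k. norm (f k) \<le> real k" and ge: "\<exists>\<^sub>\<infinity>k. norm (f k) \<ge> 1"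
  shows "conv_radius f = 1"
proof (rule antisym)
  have "\<not> summable (\<lambda>n. norm (f n * 1 ^ n))"
  proof
    assume "summable (\<lambda>n. norm (f n * 1 ^ n))"
    then have "(\<lambda>n. norm (f n)) \<longlonglongrightarrow> 0" by (auto dest: summable_LIMSEQ_zero)
    then have "eventually (\<lambda>n. norm (f n) < 1) sequentially" by (rule order_tendstoD) simp
    with ge show False
      by (auto simp: INFM_nat eventually_sequentially) (meson less_imp_le not_le)
  qed
  from conv_radius_leI[OF this] show "conv_radius f \<le> 1" by (simp add: one_ereal_def)
  show "conv_radius f \<ge> 1"
  proof (rule conv_radius_geI_ex')
    fix r :: real assume r: "0 < r" "ereal r < 1"
    then have "summable (\<lambda>n. real (Suc n) * r ^ n)"
      using geometric_deriv_sums[of r] by (auto simp: sums_iff one_ereal_def)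
    then show "summable (\<lambda>n. f n * of_real r ^ n)"
    proof (rule summable_comparison_test')
      fix n
      have "norm (f n * of_real r ^ n) = norm (f n) * r ^ n"
        using r by (simp add: norm_mult norm_power)
      also have "\<dots> \<le> real (Suc n) * r ^ n"
        using le[of n] r by (intro mult_right_mono) auto
      finally show "norm (f n * of_real r ^ n) \<le> real (Suc n) * r ^ n" .
    qed
  qed
qed

section \<open>The family of functions\<close>

lemma algebraic_poly:
  assumes "\<And>k. algebraic (coeff p k)" "algebraic z"
  shows "algebraic (poly p z)"
  unfolding poly_altdef using assms by (intro algebraic_sum algebraic_mult algebraic_power)

lemma algebraic_coeff_higher_pderiv:
  fixes p :: "'a::field_char_0 poly"
  assumes "\<And>k. algebraic (coeff p k)"
  shows "algebraic (coeff ((pderiv ^^ s) p) k)"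
  by (induction s arbitrary: k)
    (auto simp: assms coeff_pderiv simp del: of_nat_Suc intro: algebraic_mult)

text \<open>Multiplying by \<open>z ^ d\<close> keeps the nonzero coefficients and the prescribed
  zeros but raises the indices. Once \<open>d\<close> exceeds \<open>x\<close> and is at least the
  bound \<open>C\<close> on all coefficients, both the gap and the linear bound hold.\<close>

lemma ex_block:
  assumes "algebraic l" "l > 1" "finite S" "\<And>a. a \<in> S \<Longrightarrow> algebraic a \<and> norm a < 1"
  shows "\<exists>B. B \<noteq> 0 \<and> (\<forall>k. coeff B k \<in> D_lambda l) \<and> (\<forall>a\<in>S. [:- a, 1:] ^ n dvd B) \<and>
    (\<forall>k. norm (coeff B k) \<le> real k) \<and> (\<forall>k\<le>x. coeff B k = 0)"
proof -
  obtain P where P: "P \<noteq> 0" "\<And>k. coeff P k \<in> D_lambda l" "\<And>a. a \<in> S \<Longrightarrow> [:- a, 1:] ^ n dvd P"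
    using ex_poly_D_lambda_roots[OF assms, of n] by blast
  define C where "C = (\<Sum>k\<le>degree P. norm (coeff P k))"
  define d where "d = max (Suc x) (nat \<lceil>C\<rceil>)"
  have bound: "norm (coeff P k) \<le> C" for k
  proof (cases "k \<le> degree P")
    case True
    then show ?thesis unfolding C_def by (intro member_le_sum) auto
  next
    case False
    then show ?thesis by (simp add: C_def coeff_eq_0 sum_nonneg)
  qed
  have "C \<le> real d" unfolding d_def by linarith
  define B where "B = monom 1 d * P"
  have coeff_B: "coeff B k = (if k < d then 0 else coeff P (k - d))" for k
    by (simp add: B_def coeff_monom_mult)
  have "norm (coeff B k) \<le> real k" for k
  proof (cases "k < d")
    case False
    then have "norm (coeff B k) \<le> C" using bound by (simp add: coeff_B)
    then show ?thesis using \<open>C \<le> real d\<close> False by linarith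
  qed (simp add: coeff_B)
  moreover have "B \<noteq> 0" using P by (simp add: B_def)
  moreover have "coeff B k = 0" if "k \<le> x" for k
    using that by (simp add: coeff_B d_def)
  moreover have "[:- a, 1:] ^ n dvd B" if "a \<in> S" for a
    unfolding B_def by (intro dvd_mult P that)
  ultimately show ?thesis using P by (intro exI[of _ B]) (auto simp: coeff_B)
qed

text \<open>A coefficient sequence over a countable set is encoded by its graph, a set of natural
  numbers through the pairing function.\<close>

lemma fps_with_coeffs_in_countable_lepoll:
  assumes "countable A"
  shows "{F :: 'a::type fps. \<forall>k. fps_nth F k \<in> A} \<lesssim> (UNIV :: nat set set)"
  unfolding lepoll_def
proof (intro exI conjI)
  let ?g = "\<lambda>F :: 'a fps. range (\<lambda>k. prod_encode (k, to_nat_on A (fps_nth F k)))"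
  show "inj_on ?g {F. \<forall>k. fps_nth F k \<in> A}"
  proof (intro inj_onI fps_ext)
    fix F G :: "'a fps" and k
    assume F: "F \<in> {F. \<forall>k. fps_nth F k \<in> A}" and G: "G \<in> {F. \<forall>k. fps_nth F k \<in> A}" and "?g F = ?g G"
    then have "prod_encode (k, to_nat_on A (fps_nth F k)) \<in> ?g G" by blast
    then have "to_nat_on A (fps_nth F k) = to_nat_on A (fps_nth G k)" by auto
    then show "fps_nth F k = fps_nth G k" using F G assms by (simp add: inj_on_eq_iff[OF inj_on_to_nat_on])
  qed
qed simp

theorem theorem1p1:
  fixes l :: real
  assumes "algebraic l" and "l > 1"
  shows "{F :: complex fps.
            (\<forall>k. algebraic (fps_nth F k)) \<and>
            eval_fps F analytic_on ball 0 1 \<and>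
            fps_conv_radius F = 1 \<and>
            (\<forall>k. fps_nth F k \<in> D_lambda l) \<and>
            (\<forall>s. (deriv ^^ s) (eval_fps F) ` ({z. algebraic z} \<inter> ball 0 1) \<subseteq> {w. algebraic w}) \<and>
            (\<forall>s. transcendental_over_ratfuns_on (ball 0 1) ((deriv ^^ s) (eval_fps F)))}
         \<approx> (UNIV :: nat set set)"
    (is "?X \<approx> _")
proof (rule lepoll_antisym)
  have "?X \<lesssim> {F :: complex fps. \<forall>k. fps_nth F k \<in> {x. algebraic x}}"
    by (rule subset_imp_lepoll) blast
  also have "\<dots> \<lesssim> (UNIV :: nat set set)"
    by (rule fps_with_coeffs_in_countable_lepoll[OF countable_algebraic])
  finally (lepoll_trans) show "?X \<lesssim> (UNIV :: nat set set)" .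
next
  define S where "S = {z::complex. algebraic z \<and> norm z < 1}"
  have "countable S" by (rule countable_subset[OF _ countable_algebraic]) (auto simp: S_def)
  moreover have "S \<noteq> {}" by (auto simp: S_def intro: exI[of _ 0])
  ultimately obtain a :: "nat \<Rightarrow> complex" where a: "range a = S"
    using uncountable_def by metis
  \<comment> \<open>For a fixed point \<open>a j\<close> and order \<open>s\<close>, every block
    with \<open>n > max j s\<close> has a zero of order above \<open>s\<close> at
    \<open>a j\<close>.\<close>
  define good where "good n B \<longleftrightarrow> B \<noteq> 0 \<and> (\<forall>k. coeff B k \<in> D_lambda l) \<and>
    (\<forall>z\<in>a ` {..n}. [:- z, 1:] ^ Suc n dvd B) \<and> (\<forall>k. norm (coeff B k) \<le> real k)" for n B
  have ex: "\<exists>B. good n B \<and> (\<forall>k\<le>x. coeff B k = 0)" for n x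
  proof -
    have "algebraic z \<and> norm z < 1" if "z \<in> a ` {..n}" for z
      using that a by (auto simp: S_def)
    from ex_block[OF assms _ this, of "a ` {..n}" "Suc n" x]
    show ?thesis unfolding good_def by auto
  qed
  \<comment> \<open>Dependent choice, because the place where block \<open>n + 1\<close> may start
    depends on the degree of block \<open>n\<close>.\<close>
  have "\<exists>B. \<forall>n. good n (B n) \<and> (\<forall>k\<le>(n + 1) * (degree (B n) + 1). coeff (B (Suc n)) k = 0)"
    by (rule dependent_nat_choice) (use ex in blast)+
  then obtain B where B: "\<And>n. good n (B n)"
      and low: "\<And>n k. k \<le> (n + 1) * (degree (B n) + 1) \<Longrightarrow> coeff (B (Suc n)) k = 0"
    by blast
  interpret lacunary_blocks B
    by unfold_locales (use B low in \<open>auto simp: good_def\<close>)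
  \<comment> \<open>Signs rather than 0 and 1 keep every block present, which serves both the radius
    and the transcendence argument.\<close>
  define sgn_of where "sgn_of A n = (if n \<in> A then 1 else - 1 :: complex)" for A and n :: nat
  have sgn_nz: "sgn_of A n \<noteq> 0" and sgn_norm: "norm (sgn_of A n) = 1" for A n
    by (auto simp: sgn_of_def)
  have sgn_mult: "sgn_of A n * x \<in> D_lambda l" if "x \<in> D_lambda l" for A n x
    using that by (auto simp: sgn_of_def D_lambda_uminus)
  have B_D: "coeff (B n) k \<in> D_lambda l" and B_norm: "norm (coeff (B n) k) \<le> real k" for n k
    using B[of n] by (auto simp: good_def)
  have "series (sgn_of A) \<in> ?X" for A
  proof -
    define F where "F = series (sgn_of A)"
    have F_D: "fps_nth F k \<in> D_lambda l" for k
      unfolding F_def using series_nth_cases[of "sgn_of A" k] sgn_mult B_D by auto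
    have F_norm: "norm (fps_nth F k) \<le> real k" for k
      unfolding F_def using series_nth_cases[of "sgn_of A" k] B_norm by (auto simp: norm_mult sgn_norm)
    \<comment> \<open>A nonzero element of \<open>D_lambda l\<close> has modulus at least 1. The
      degrees of the blocks supply infinitely many such coefficients, which caps the radius at
      1.\<close>
    have "norm (fps_nth F (degree (B n))) \<ge> 1" for n
    proof (rule D_lambda_norm_ge_1[OF F_D _ assms(2)])
      show "fps_nth F (degree (B n)) \<noteq> 0"
        using B_nonzero sgn_nz by (simp add: F_def series_nth_degree_B)
    qed
    then have "\<exists>\<^sub>\<infinity>k. norm (fps_nth F k) \<ge> 1"
      unfolding INFM_nat_le using degree_B_ge by blast
    with F_norm have radius: "fps_conv_radius F = 1"
      unfolding fps_conv_radius_def by (intro conv_radius_eq_1_if_coeffs_between)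
    have deriv_F: "(deriv ^^ s) (eval_fps F) z = eval_fps ((fps_deriv ^^ s) F) z" if "z \<in> ball 0 1" for s z
      using that radius by (intro higher_deriv_eval_fps) (simp add: one_ereal_def)
    have "algebraic ((deriv ^^ s) (eval_fps F) z)" if z: "algebraic z" "z \<in> ball 0 1" for s z
    proof -
      obtain j where j: "z = a j" using z a by (auto simp: S_def)
      define N where "N = max j s"
      have dvd: "[:- z, 1:] ^ Suc s dvd B n" if "n > N" for n
      proof -
        have "[:- z, 1:] ^ Suc s dvd [:- z, 1:] ^ Suc n"
          using that by (intro le_imp_power_dvd) (simp add: N_def)
        also have "\<dots> dvd B n"
        proof -
          have "z \<in> a ` {..n}" using that unfolding j N_def by (intro imageI) auto
          then show ?thesis using B[of n] unfolding good_def by blast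
        qed
        finally show ?thesis .
      qed
      have "(deriv ^^ s) (eval_fps F) z = poly ((pderiv ^^ s) (trunc (sgn_of A) N)) z"
        unfolding deriv_F[OF z(2)] unfolding F_def
      proof (rule eval_series_higher_deriv)
        show "ereal (norm z) < fps_conv_radius (series (sgn_of A))"
          using z(2) radius unfolding F_def by (simp add: one_ereal_def)
      qed (fact dvd)
      also have "algebraic \<dots>"
      proof (intro algebraic_poly algebraic_coeff_higher_pderiv z)
        fix k
        show "algebraic (coeff (trunc (sgn_of A) N) k)"
          unfolding trunc_def coeff_sum coeff_smult
          by (intro algebraic_sum D_lambda_algebraic[of _ l] sgn_mult B_D)
      qed
      finally show ?thesis .
    qed
    moreover have "transcendental_over_ratfuns_on (ball 0 1) ((deriv ^^ s) (eval_fps F))" for s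
    proof -
      have "fps_conv_radius ((fps_deriv ^^ s) F) > 0"
        by (rule less_le_trans[OF _ fps_conv_radius_higher_deriv]) (simp add: radius)
      with zero_less_one have "transcendental_over_ratfuns_on (ball 0 1) (eval_fps ((fps_deriv ^^ s) F))"
        unfolding F_def
        by (rule transcendental_over_ratfuns_on_eval_fps)
          (rule series_higher_deriv_transcendental[OF sgn_nz])
      moreover have "transcendental_over_ratfuns_on (ball 0 1) ((deriv ^^ s) (eval_fps F)) \<longleftrightarrow>
          transcendental_over_ratfuns_on (ball 0 1) (eval_fps ((fps_deriv ^^ s) F))"
        by (rule transcendental_over_ratfuns_on_cong) (rule deriv_F)
      ultimately show ?thesis by (rule rev_iffD2)
    qed
    moreover have "eval_fps F analytic_on ball 0 1"
      by (intro analytic_on_eval_fps) (auto simp: radius one_ereal_def)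
    ultimately have "F \<in> ?X"
      using F_D radius D_lambda_algebraic[OF F_D] by (intro CollectI conjI allI) auto
    then show ?thesis unfolding F_def .
  qed
  moreover have "inj (\<lambda>A. series (sgn_of A))"
  proof (rule injI)
    fix A A' assume "series (sgn_of A) = series (sgn_of A')"
    then have "sgn_of A = sgn_of A'" by (rule injD[OF inj_series])
    moreover have "n \<in> A \<longleftrightarrow> sgn_of A n = 1" for A n by (simp add: sgn_of_def)
    ultimately show "A = A'" by (simp add: set_eq_iff)
  qed
  ultimately show "(UNIV :: nat set set) \<lesssim> ?X"
    unfolding lepoll_def by blast
qed

end
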